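(* Let $M$ be a smooth paracompact manifold with $\dim M\ge 3$, and let $F$ be a smooth positively-homogeneous function on $T^\circ M$ such that for every $x\in M$ the Hessian of $F$ (with respect to the fibre coordinates) on $T^\circ_xM$ is positive quasi-definite. Then for any $x_0\in M$ there is a neighbourhood $U$ of $x_0$ in $M$ and a function $\tilde F$ defined on $T^\circ U$ such that $\tilde F$ is a Finsler function which differs from $F$ (on $T^\circ U$) by a total derivative. If $F$ is absolutely, rather than just positively, homogeneous then $F$ itself is a Finsler function.
   Context: $T^\circ M$ is the slit tangent bundle of $M$ ($TM$ with the zero section removed), $T^\circ_xM=T_xM\setminus\{0\}$, and $T^\circ U$ is the part of $T^\circ M$ over $U$. $(x^i,y^i)$ are canonical coordinates on $TM$; summation convention is used. A function $F$ on $T^\circ M$ is positively homogeneous if $F(x,ky)=kF(x,y)$ for all $k>0$, and absolutely homogeneous if $F(x,ky)=|k|F(x,y)$ for all real $k\neq0$. The Hessian is $\frac{\partial^2F}{\partial y^i\partial y^j}$; it is positive quasi-definite if, for each $y\ne0$, $\frac{\partial^2F}{\partial y^i\partial y^j}(y)v^iv^j\ge0$ for all $v$, with equality only if $v$ is a scalar multiple of $y$. A Finsler function is a smooth function on the slit tangent bundle which is positive, positively homogeneous, and strongly convex, meaning that $F\frac{\partial^2F}{\partial y^i\partial y^j}+\frac{\partial F}{\partial y^i}\frac{\partial F}{\partial y^j}$ is positive definite. A total derivative is a function of the form $y^i\frac{\partial\phi}{\partial x^i}$, where $\phi$ is a smooth function on the relevant open subset of $M$. *)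

theory Defs
  imports "HOL-Analysis.Analysis"
begin

text \<open>\<open>Ck_on\<close> and \<open>smooth_on\<close> are meant for open \<open>S\<close> and finite-dimensional domains.\<close>

fun Ck_on :: "nat \<Rightarrow> 'a::real_normed_vector set \<Rightarrow> ('a \<Rightarrow> 'b::real_normed_vector) \<Rightarrow> bool" where
  "Ck_on 0 S f \<longleftrightarrow> continuous_on S f"
| "Ck_on (Suc k) S f \<longleftrightarrow>
     (\<forall>x\<in>S. f differentiable (at x)) \<and> (\<forall>v. Ck_on k S (\<lambda>x. frechet_derivative f (at x) v))"

definition smooth_on :: "'a::real_normed_vector set \<Rightarrow> ('a \<Rightarrow> 'b::real_normed_vector) \<Rightarrow> bool" where
  "smooth_on S f \<longleftrightarrow> (\<forall>k. Ck_on k S f)"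

definition partial :: "'n::finite \<Rightarrow> (real^'n \<Rightarrow> real) \<Rightarrow> real^'n \<Rightarrow> real" where
  "partial i f x = frechet_derivative f (at x) (axis i 1)"

definition hessian :: "(real^'n::finite \<Rightarrow> real) \<Rightarrow> real^'n \<Rightarrow> real^'n^'n" where
  "hessian f y = (\<chi> i j. partial i (partial j f) y)"

definition paracompact_space :: "'a topology \<Rightarrow> bool" where
  "paracompact_space X \<longleftrightarrow>
     (\<forall>\<U>. (\<forall>U\<in>\<U>. openin X U) \<and> \<Union>\<U> = topspace X \<longrightarrow>
        (\<exists>\<V>. (\<forall>V\<in>\<V>. openin X V \<and> (\<exists>U\<in>\<U>. V \<subseteq> U)) \<and> \<Union>\<V> = topspace X \<and>
             locally_finite_in X \<V>))"

text \<open>A chart is a domain together with its coordinate map; the values of the coordinate map outside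
  the domain are irrelevant.\<close>

type_synonym ('a, 'n) chart = "'a set \<times> ('a \<Rightarrow> real^'n)"

abbreviation chart_dom :: "('a, 'n::finite) chart \<Rightarrow> 'a set" where
  "chart_dom \<equiv> fst"

abbreviation chart_map :: "('a, 'n::finite) chart \<Rightarrow> 'a \<Rightarrow> real^'n" where
  "chart_map \<equiv> snd"

definition chart_inv :: "('a, 'n::finite) chart \<Rightarrow> real^'n \<Rightarrow> 'a" where
  "chart_inv c = inv_into (chart_dom c) (chart_map c)"

definition is_chart :: "'a topology \<Rightarrow> ('a, 'n::finite) chart \<Rightarrow> bool" where
  "is_chart M c \<longleftrightarrow>
     openin M (chart_dom c) \<and> open (chart_map c ` chart_dom c) \<and>
     homeomorphic_map (subtopology M (chart_dom c))
       (top_of_set (chart_map c ` chart_dom c)) (chart_map c)"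

definition smooth_manifold :: "'a topology \<Rightarrow> ('a, 'n::finite) chart set \<Rightarrow> bool" where
  "smooth_manifold M A \<longleftrightarrow>
     Hausdorff_space M \<and>
     (\<forall>c\<in>A. is_chart M c) \<and>
     (\<Union>c\<in>A. chart_dom c) = topspace M \<and>
     (\<forall>c\<in>A. \<forall>d\<in>A. smooth_on (chart_map c ` (chart_dom c \<inter> chart_dom d)) (chart_map d \<circ> chart_inv c))"

definition smooth_fun :: "('a, 'n::finite) chart set \<Rightarrow> 'a set \<Rightarrow> ('a \<Rightarrow> real) \<Rightarrow> bool" where
  "smooth_fun A U \<phi> \<longleftrightarrow>
     (\<forall>c\<in>A. smooth_on (chart_map c ` (U \<inter> chart_dom c)) (\<phi> \<circ> chart_inv c))"

text \<open>A tangent vector at \<open>p\<close> is given by its components \<open>v c\<close> in every chart \<open>c\<close> of the atlas around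
  \<open>p\<close>, where the components in different charts are related by the derivative of the change of
  coordinates. Entries for other charts are normalised to 0, so that the zero tangent vector is the
  zero function and the vector space operations are pointwise.\<close>

type_synonym ('a, 'n) tangent = "('a, 'n) chart \<Rightarrow> real^'n"

definition tangent_space :: "('a, 'n::finite) chart set \<Rightarrow> 'a \<Rightarrow> ('a, 'n) tangent set" where
  "tangent_space A p =
     {v. (\<forall>c\<in>A. \<forall>d\<in>A. p \<in> chart_dom c \<and> p \<in> chart_dom d \<longrightarrow>
            v d = frechet_derivative (chart_map d \<circ> chart_inv c) (at (chart_map c p)) (v c)) \<and>
         (\<forall>c. c \<notin> A \<or> p \<notin> chart_dom c \<longrightarrow> v c = 0)}"

definition slit_bundle :: "('a, 'n::finite) chart set \<Rightarrow> 'a set \<Rightarrow> ('a \<times> ('a, 'n) tangent) set" where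
  "slit_bundle A U = {(p, v). p \<in> U \<and> v \<in> tangent_space A p \<and> v \<noteq> (\<lambda>_. 0)}"

definition scale_tangent :: "real \<Rightarrow> ('a, 'n::finite) tangent \<Rightarrow> ('a, 'n) tangent" where
  "scale_tangent k v = (\<lambda>c. k *\<^sub>R v c)"

definition bundle_coord :: "('a, 'n::finite) chart \<Rightarrow> 'a \<times> ('a, 'n) tangent \<Rightarrow> (real^'n) \<times> (real^'n)" where
  "bundle_coord c = (\<lambda>(p, v). (chart_map c p, v c))"

lemma chart_inv_map:
  assumes "is_chart M c" "p \<in> chart_dom c"
  shows "chart_inv c (chart_map c p) = p"
proof -
  have "inj_on (chart_map c) (chart_dom c)"
    using assms(1) unfolding is_chart_def
    by (metis homeomorphic_imp_injective_map openin_subset topspace_subtopology_subset)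
  then show ?thesis using assms(2) by (simp add: chart_inv_def)
qed

lemma open_chart_image:
  assumes "is_chart M c" "openin M U" "U \<subseteq> chart_dom c"
  shows "open (chart_map c ` U)"
proof -
  have h: "homeomorphic_map (subtopology M (chart_dom c))
       (top_of_set (chart_map c ` chart_dom c)) (chart_map c)"
    and o: "open (chart_map c ` chart_dom c)" using assms(1) by (auto simp: is_chart_def)
  have "openin (subtopology M (chart_dom c)) U" using assms(2,3)
    by (metis inf.absorb_iff1 openin_subtopology_Int)
  then have "openin (top_of_set (chart_map c ` chart_dom c)) (chart_map c ` U)"
    using homeomorphic_imp_open_map[OF h] by (auto simp: open_map_def)
  with o show ?thesis by (metis openin_open_trans)
qed

lemma transition_derivative:
  assumes "smooth_manifold M A" "c \<in> A" "d \<in> A" "p \<in> chart_dom c" "p \<in> chart_dom d"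
  shows "((chart_map d \<circ> chart_inv c) has_derivative
           frechet_derivative (chart_map d \<circ> chart_inv c) (at (chart_map c p))) (at (chart_map c p))"
proof -
  have "Ck_on (Suc 0) (chart_map c ` (chart_dom c \<inter> chart_dom d)) (chart_map d \<circ> chart_inv c)"
    using assms unfolding smooth_manifold_def smooth_on_def by blast
  then have "(chart_map d \<circ> chart_inv c) differentiable (at (chart_map c p))"
    using assms by auto
  then show ?thesis by (simp add: frechet_derivative_works)
qed

lemma transition_cocycle:
  assumes "smooth_manifold M A" "b \<in> A" "c \<in> A" "d \<in> A"
    "p \<in> chart_dom b" "p \<in> chart_dom c" "p \<in> chart_dom d"
  shows "frechet_derivative (chart_map d \<circ> chart_inv c) (at (chart_map c p))
           (frechet_derivative (chart_map c \<circ> chart_inv b) (at (chart_map b p)) y) =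
         frechet_derivative (chart_map d \<circ> chart_inv b) (at (chart_map b p)) y"
proof -
  let ?U = "chart_dom b \<inter> chart_dom c \<inter> chart_dom d"
  have ch: "is_chart M b" "is_chart M c" "is_chart M d"
    using assms by (auto simp: smooth_manifold_def)
  have op: "open (chart_map b ` ?U)"
    using ch by (intro open_chart_image[of M]) (auto simp: is_chart_def)
  have eq: "((chart_map d \<circ> chart_inv c) \<circ> (chart_map c \<circ> chart_inv b)) x = (chart_map d \<circ> chart_inv b) x"
    if "x \<in> chart_map b ` ?U" for x
    using that chart_inv_map[OF ch(1)] chart_inv_map[OF ch(2)] by auto
  have D1: "((chart_map c \<circ> chart_inv b) has_derivative
      frechet_derivative (chart_map c \<circ> chart_inv b) (at (chart_map b p))) (at (chart_map b p))"
    using assms by (intro transition_derivative)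
  have p1: "(chart_map c \<circ> chart_inv b) (chart_map b p) = chart_map c p"
    using chart_inv_map[OF ch(1)] assms by simp
  have D2: "((chart_map d \<circ> chart_inv c) has_derivative
      frechet_derivative (chart_map d \<circ> chart_inv c) (at (chart_map c p)))
        (at ((chart_map c \<circ> chart_inv b) (chart_map b p)))"
    unfolding p1 using assms by (intro transition_derivative)
  have "((chart_map d \<circ> chart_inv b) has_derivative
     frechet_derivative (chart_map d \<circ> chart_inv c) (at (chart_map c p)) \<circ>
     frechet_derivative (chart_map c \<circ> chart_inv b) (at (chart_map b p))) (at (chart_map b p))"
    using diff_chain_at[OF D1 D2]
    by (rule has_derivative_transform_within_open[OF _ op]) (use eq assms in auto)
  moreover have "((chart_map d \<circ> chart_inv b) has_derivative
      frechet_derivative (chart_map d \<circ> chart_inv b) (at (chart_map b p))) (at (chart_map b p))"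
    using assms by (intro transition_derivative)
  ultimately show ?thesis
    by (metis comp_apply has_derivative_unique)
qed

lemma transition_refl:
  assumes "smooth_manifold M A" "c \<in> A" "p \<in> chart_dom c"
  shows "frechet_derivative (chart_map c \<circ> chart_inv c) (at (chart_map c p)) y = y"
proof -
  have ch: "is_chart M c" using assms by (auto simp: smooth_manifold_def)
  have "((chart_map c \<circ> chart_inv c) has_derivative (\<lambda>y. y)) (at (chart_map c p))"
    by (rule has_derivative_transform_within_open[OF has_derivative_ident, of "chart_map c ` chart_dom c"])
      (use ch assms chart_inv_map[OF ch] in \<open>auto simp: is_chart_def\<close>)
  then show ?thesis
    by (metis frechet_derivative_at)
qed

text \<open>This shows that the inverse coordinate maps used below are genuine inverses.\<close>

lemma bij_betw_bundle_coord:
  fixes A :: "('a, 'n::finite) chart set"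
  assumes "smooth_manifold M A" "c \<in> A" "U \<subseteq> chart_dom c"
  shows "bij_betw (bundle_coord c) (slit_bundle A U) ((chart_map c ` U) \<times> (- {0}))"
  unfolding bij_betw_def
proof
  have ch: "is_chart M c" using assms by (auto simp: smooth_manifold_def)
  have det: "v d = (if d \<in> A \<and> p \<in> chart_dom d then
       frechet_derivative (chart_map d \<circ> chart_inv c) (at (chart_map c p)) (v c) else 0)"
    if "v \<in> tangent_space A p" "p \<in> U" for v p d
    using that assms unfolding tangent_space_def mem_Collect_eq by (smt (verit) subsetD)
  show "inj_on (bundle_coord c) (slit_bundle A U)"
  proof (rule inj_onI, clarify)
    fix p v q w assume a: "(p, v) \<in> slit_bundle A U" "(q, w) \<in> slit_bundle A U"
      "bundle_coord c (p, v) = bundle_coord c (q, w)"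
    then have *: "p \<in> U" "q \<in> U" "chart_map c p = chart_map c q" "v c = w c"
      "v \<in> tangent_space A p" "w \<in> tangent_space A q"
      by (auto simp: slit_bundle_def bundle_coord_def)
    then have "p = q" by (metis chart_inv_map[OF ch] assms(3) subsetD)
    moreover have "v = w" using * \<open>p = q\<close> det[of v p] det[of w p] by (intro ext) simp
    ultimately show "p = q \<and> v = w" by simp
  qed
  show "bundle_coord c ` slit_bundle A U = (chart_map c ` U) \<times> (- {0})"
  proof (intro equalityI subsetI)
    fix z assume "z \<in> bundle_coord c ` slit_bundle A U"
    then obtain p v where z: "z = (chart_map c p, v c)" "p \<in> U" "v \<in> tangent_space A p" "v \<noteq> (\<lambda>_. 0)"
      by (auto simp: slit_bundle_def bundle_coord_def)
    have "v c \<noteq> 0"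
    proof
      assume 0: "v c = 0"
      have "v d = 0" for d
      proof (cases "d \<in> A \<and> p \<in> chart_dom d")
        case True
        then have "bounded_linear (frechet_derivative (chart_map d \<circ> chart_inv c) (at (chart_map c p)))"
          using transition_derivative[OF assms(1,2)] z assms(3)
          by (blast intro: has_derivative_bounded_linear)
        then show ?thesis using det[OF z(3,2), of d] True 0
          by (simp add: linear_simps)
      qed (use det[OF z(3,2), of d] in auto)
      with z(4) show False by auto
    qed
    with z show "z \<in> (chart_map c ` U) \<times> (- {0})" by auto
  next
    fix z assume "z \<in> (chart_map c ` U) \<times> (- {0::real^'n})"
    then obtain p y where z: "z = (chart_map c p, y)" "p \<in> U" "y \<noteq> 0" by auto
    define v where "v = (\<lambda>d. if d \<in> A \<and> p \<in> chart_dom d then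
       frechet_derivative (chart_map d \<circ> chart_inv c) (at (chart_map c p)) y else 0)"
    have pc: "p \<in> chart_dom c" using z assms by auto
    have "v c = y" using transition_refl[OF assms(1,2) pc] pc assms by (simp add: v_def)
    moreover have "v \<in> tangent_space A p"
      using transition_cocycle[OF assms(1,2)] pc by (auto simp: tangent_space_def v_def)
    ultimately have "(p, v) \<in> slit_bundle A U" "bundle_coord c (p, v) = z"
      using z by (auto simp: slit_bundle_def bundle_coord_def)
    then show "z \<in> bundle_coord c ` slit_bundle A U" by force
  qed
qed

definition coord_rep ::
  "('a, 'n::finite) chart set \<Rightarrow> ('a, 'n) chart \<Rightarrow> ('a \<times> ('a, 'n) tangent \<Rightarrow> real) \<Rightarrow>
     (real^'n) \<times> (real^'n) \<Rightarrow> real" where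
  "coord_rep A c F = F \<circ> inv_into (slit_bundle A (chart_dom c)) (bundle_coord c)"

definition smooth_on_slit ::
  "('a, 'n::finite) chart set \<Rightarrow> 'a set \<Rightarrow> ('a \<times> ('a, 'n) tangent \<Rightarrow> real) \<Rightarrow> bool" where
  "smooth_on_slit A U F \<longleftrightarrow>
     (\<forall>c\<in>A. smooth_on (bundle_coord c ` slit_bundle A (U \<inter> chart_dom c)) (coord_rep A c F))"

definition positively_homogeneous ::
  "('a, 'n::finite) chart set \<Rightarrow> 'a set \<Rightarrow> ('a \<times> ('a, 'n) tangent \<Rightarrow> real) \<Rightarrow> bool" where
  "positively_homogeneous A U F \<longleftrightarrow>
     (\<forall>(p, v)\<in>slit_bundle A U. \<forall>k>0. F (p, scale_tangent k v) = k * F (p, v))"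

definition absolutely_homogeneous ::
  "('a, 'n::finite) chart set \<Rightarrow> 'a set \<Rightarrow> ('a \<times> ('a, 'n) tangent \<Rightarrow> real) \<Rightarrow> bool" where
  "absolutely_homogeneous A U F \<longleftrightarrow>
     (\<forall>(p, v)\<in>slit_bundle A U. \<forall>k. k \<noteq> 0 \<longrightarrow> F (p, scale_tangent k v) = \<bar>k\<bar> * F (p, v))"

definition fibre_rep ::
  "('a, 'n::finite) chart set \<Rightarrow> ('a, 'n) chart \<Rightarrow> ('a \<times> ('a, 'n) tangent \<Rightarrow> real) \<Rightarrow> 'a \<Rightarrow>
     real^'n \<Rightarrow> real" where
  "fibre_rep A c F p = (\<lambda>y. coord_rep A c F (chart_map c p, y))"

definition positive_quasi_definite_hessian :: "(real^'n::finite \<Rightarrow> real) \<Rightarrow> bool" where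
  "positive_quasi_definite_hessian f \<longleftrightarrow>
     (\<forall>y. y \<noteq> 0 \<longrightarrow>
        (\<forall>v. 0 \<le> v \<bullet> (hessian f y *v v) \<and>
             (v \<bullet> (hessian f y *v v) = 0 \<longrightarrow> (\<exists>k. v = k *\<^sub>R y))))"

definition fibrewise_quasi_definite ::
  "('a, 'n::finite) chart set \<Rightarrow> 'a set \<Rightarrow> ('a \<times> ('a, 'n) tangent \<Rightarrow> real) \<Rightarrow> bool" where
  "fibrewise_quasi_definite A U F \<longleftrightarrow>
     (\<forall>c\<in>A. \<forall>p\<in>U \<inter> chart_dom c. positive_quasi_definite_hessian (fibre_rep A c F p))"

definition positive_definite_matrix :: "real^'n^'n::finite \<Rightarrow> bool" where
  "positive_definite_matrix B \<longleftrightarrow> (\<forall>v. v \<noteq> 0 \<longrightarrow> 0 < v \<bullet> (B *v v))"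

definition strongly_convex ::
  "('a, 'n::finite) chart set \<Rightarrow> 'a set \<Rightarrow> ('a \<times> ('a, 'n) tangent \<Rightarrow> real) \<Rightarrow> bool" where
  "strongly_convex A U F \<longleftrightarrow>
     (\<forall>c\<in>A. \<forall>p\<in>U \<inter> chart_dom c. \<forall>y. y \<noteq> 0 \<longrightarrow>
        (let f = fibre_rep A c F p in
         positive_definite_matrix
           (\<chi> i j. f y * hessian f y $ i $ j + partial i f y * partial j f y)))"

definition finsler_function ::
  "('a, 'n::finite) chart set \<Rightarrow> 'a set \<Rightarrow> ('a \<times> ('a, 'n) tangent \<Rightarrow> real) \<Rightarrow> bool" where
  "finsler_function A U F \<longleftrightarrow>
     smooth_on_slit A U F \<and>
     (\<forall>z\<in>slit_bundle A U. 0 < F z) \<and>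
     positively_homogeneous A U F \<and>
     strongly_convex A U F"

definition total_derivative ::
  "('a, 'n::finite) chart set \<Rightarrow> 'a set \<Rightarrow> ('a \<times> ('a, 'n) tangent \<Rightarrow> real) \<Rightarrow> bool" where
  "total_derivative A U G \<longleftrightarrow>
     (\<exists>\<phi>. smooth_fun A U \<phi> \<and>
        (\<forall>(p, v)\<in>slit_bundle A U. \<forall>c\<in>A. p \<in> chart_dom c \<longrightarrow>
           G (p, v) = (\<Sum>i\<in>UNIV. v c $ i * partial i (\<phi> \<circ> chart_inv c) (chart_map c p))))"

end

theory Submission
  imports Defs
begin

text \<open>On a single fibre \<open>f = F(x, \<cdot>)\<close>, convexity along the segment from \<open>w\<close> to \<open>y\<close> and Euler's relation
  \<open>df\<^sub>w(w) = f(w)\<close> give \<open>f(y) > df\<^sub>w(y)\<close> unless \<open>y\<close> is a multiple of \<open>w\<close>. Comparing \<open>f(w)\<close> and \<open>f(-w)\<close>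
  with \<open>df\<^sub>u(w)\<close> and \<open>df\<^sub>u(-w)\<close> for some \<open>u\<close> independent of \<open>w\<close> yields \<open>f(w) + f(-w) > 0\<close>, which settles
  the absolutely homogeneous case. In general it follows that \<open>f - (df\<^sub>w + df\<^bsub>-w\<^esub>)/2\<close> is positive away
  from 0. The subtracted covector at \<open>x\<^sub>0\<close>, extended with constant coefficients in a chart, is a total
  derivative, and positivity persists near \<open>x\<^sub>0\<close> by compactness of the sphere. Strong convexity follows
  from positivity and quasi-definiteness, since the derivative of \<open>f\<close> at \<open>y\<close> does not vanish on \<open>y\<close>.\<close>

section \<open>Calculus of smooth functions\<close>

lemma Ck_on_imp_differentiable: "Ck_on (Suc k) S f \<Longrightarrow> x \<in> S \<Longrightarrow> f differentiable (at x)"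
  by simp

lemma Ck_on_Suc_imp: "Ck_on (Suc k) S f \<Longrightarrow> Ck_on k S f"
proof (induction k arbitrary: f)
  case 0
  then show ?case
    by (auto intro!: continuous_at_imp_continuous_on differentiable_imp_continuous_within)
next
  case (Suc k)
  from Suc.prems have 1: "\<forall>x\<in>S. f differentiable (at x)"
    and 2: "\<And>v. Ck_on (Suc k) S (\<lambda>x. frechet_derivative f (at x) v)"
    unfolding Ck_on.simps(2)[of "Suc k"] by blast+
  show ?case
    unfolding Ck_on.simps(2)[of k] using 1 Suc.IH[OF 2] by blast
qed

lemma Ck_on_subset: "Ck_on k S f \<Longrightarrow> T \<subseteq> S \<Longrightarrow> Ck_on k T f"
proof (induction k arbitrary: f)
  case 0
  then show ?case by (auto intro: continuous_on_subset)
next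
  case (Suc k)
  then show ?case unfolding Ck_on.simps by blast
qed

text \<open>\<open>frechet_derivative\<close> is a choice among all derivatives at the point.
  Functions agreeing near \<open>x\<close> have the same candidates, so the choices coincide whether
  or not the functions are differentiable.\<close>

lemma frechet_derivative_cong_open:
  assumes "open S" "x \<in> S" "\<And>x. x \<in> S \<Longrightarrow> f x = g x"
  shows "frechet_derivative f (at x) = frechet_derivative g (at x)"
proof -
  have "(f has_derivative D) (at x) \<longleftrightarrow> (g has_derivative D) (at x)" for D
    using assms by (metis has_derivative_transform_within_open)
  then show ?thesis by (simp add: frechet_derivative_def)
qed

lemma Ck_on_cong:
  assumes "open S" "\<And>x. x \<in> S \<Longrightarrow> f x = g x" "Ck_on k S f"
  shows "Ck_on k S g"
  using assms(2,3)
proof (induction k arbitrary: f g)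
  case 0
  then show ?case using continuous_on_cong[of S S f g] by simp
next
  case (Suc k)
  have "g differentiable (at x)" if x: "x \<in> S" for x
  proof -
    obtain D where "(f has_derivative D) (at x)"
      using Suc.prems(2) x by (auto simp: differentiable_def)
    then have "(g has_derivative D) (at x)"
      by (rule has_derivative_transform_within_open[OF _ assms(1) x Suc.prems(1)])
    then show ?thesis by (rule differentiableI)
  qed
  moreover have "Ck_on k S (\<lambda>x. frechet_derivative g (at x) v)" for v
  proof (rule Suc.IH)
    show "frechet_derivative f (at x) v = frechet_derivative g (at x) v" if "x \<in> S" for x
      using frechet_derivative_cong_open[OF assms(1) that Suc.prems(1)] by simp
    show "Ck_on k S (\<lambda>x. frechet_derivative f (at x) v)"
      using Suc.prems(2) by simp
  qed
  ultimately show ?case by simp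
qed

text \<open>Serves as the introduction rule for the inductions on \<open>k\<close>: any explicit
  derivative \<open>D\<close> may replace the chosen \<open>frechet_derivative\<close>, by
  uniqueness of derivatives.\<close>

lemma Ck_on_SucI:
  assumes "open S" "\<And>x. x \<in> S \<Longrightarrow> (f has_derivative D x) (at x)" "\<And>v. Ck_on k S (\<lambda>x. D x v)"
  shows "Ck_on (Suc k) S f"
proof -
  have "Ck_on k S (\<lambda>x. frechet_derivative f (at x) v)" for v
    by (rule Ck_on_cong[OF assms(1) _ assms(3)[of v]]) (metis assms(2) frechet_derivative_at)
  then show ?thesis using assms(2) by (auto simp: differentiable_def)
qed

lemma Ck_on_derivative:
  "Ck_on (Suc k) S f \<Longrightarrow> x \<in> S \<Longrightarrow> (f has_derivative frechet_derivative f (at x)) (at x)"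
  by (simp add: frechet_derivative_works)

lemma Ck_on_const: "open S \<Longrightarrow> Ck_on k S (\<lambda>_. c)"
proof (induction k arbitrary: c)
  case (Suc k)
  show ?case
    by (rule Ck_on_SucI[OF Suc.prems, of _ "\<lambda>_ _. 0"]) (use Suc in auto)
qed simp

lemma Ck_on_linear:
  assumes "open S" "bounded_linear L"
  shows "Ck_on k S L"
proof (cases k)
  case 0
  then show ?thesis using assms by (simp add: linear_continuous_on)
next
  case (Suc m)
  show ?thesis unfolding Suc
    by (rule Ck_on_SucI[OF assms(1), of _ "\<lambda>_. L"])
      (auto intro: bounded_linear_imp_has_derivative assms Ck_on_const)
qed

lemma Ck_on_add:
  assumes "open S" "Ck_on k S f" "Ck_on k S g"
  shows "Ck_on k S (\<lambda>x. f x + g x)"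
  using assms(2,3)
proof (induction k arbitrary: f g)
  case 0
  then show ?case by (auto intro: continuous_intros)
next
  case (Suc k)
  show ?case
    by (rule Ck_on_SucI[OF assms(1) has_derivative_add[OF Ck_on_derivative Ck_on_derivative]])
      (use Suc in auto)
qed

lemma Ck_on_sum:
  assumes "open S" "\<And>i. i \<in> I \<Longrightarrow> Ck_on k S (f i)"
  shows "Ck_on k S (\<lambda>x. \<Sum>i\<in>I. f i x)"
  using assms(2)
proof (induction I rule: infinite_finite_induct)
  case (insert i I)
  then have "Ck_on k S (\<lambda>x. f i x + (\<Sum>i\<in>I. f i x))"
    by (intro Ck_on_add[OF assms(1)]) blast+
  with insert show ?case by simp
qed (simp_all add: Ck_on_const[OF assms(1)])

text \<open>The product rule pairs a factor with the derivative of the other;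
  \<open>Ck_on_Suc_imp\<close> lowers the undifferentiated factor to order \<open>k\<close>, so that
  the induction hypothesis applies.\<close>

lemma Ck_on_mult:
  fixes f g :: "'a::real_normed_vector \<Rightarrow> real"
  assumes "open S" "Ck_on k S f" "Ck_on k S g"
  shows "Ck_on k S (\<lambda>x. f x * g x)"
  using assms(2,3)
proof (induction k arbitrary: f g)
  case 0
  then show ?case by (auto intro: continuous_intros)
next
  case (Suc k)
  show ?case
    by (rule Ck_on_SucI[OF assms(1) has_derivative_mult[OF Ck_on_derivative Ck_on_derivative]])
      (use Suc Ck_on_Suc_imp[OF Suc.prems(1)] Ck_on_Suc_imp[OF Suc.prems(2)] in
        \<open>auto intro!: Ck_on_add assms(1)\<close>)
qed

text \<open>As \<open>L\<close> does not vary with the point, a directional derivative of the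
  composite is again a directional derivative of \<open>f\<close> composed with \<open>h\<close>,
  and the induction closes. The instances needed are the inclusion of a fibre and the projection to
  the base.\<close>

lemma Ck_on_compose_affine:
  assumes "open T" "\<And>x. x \<in> T \<Longrightarrow> (h has_derivative L) (at x)" "h ` T \<subseteq> S" "Ck_on k S f"
  shows "Ck_on k T (\<lambda>x. f (h x))"
  using assms(4)
proof (induction k arbitrary: f)
  case 0
  have "continuous_on T h"
    by (metis assms(2) continuous_at_imp_continuous_on has_derivative_continuous)
  with 0 assms(3) show ?case by (auto intro: continuous_on_compose2)
next
  case (Suc k)
  show ?case
  proof (rule Ck_on_SucI[OF assms(1)])
    fix x assume "x \<in> T"
    then show "((\<lambda>x. f (h x)) has_derivative (\<lambda>v. frechet_derivative f (at (h x)) (L v))) (at x)"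
      using has_derivative_compose[OF assms(2) Ck_on_derivative[OF Suc.prems]] assms(3) by auto
  next
    show "Ck_on k T (\<lambda>x. frechet_derivative f (at (h x)) (L v))" for v
      using Suc.IH[of "\<lambda>x. frechet_derivative f (at x) (L v)"] Suc.prems by simp
  qed
qed

lemma Ck_on_linear_compose:
  assumes "open S" "bounded_linear L" "Ck_on k S f"
  shows "Ck_on k S (\<lambda>x. L (f x))"
  using assms(3)
proof (induction k arbitrary: f)
  case 0
  then show ?case using bounded_linear.continuous_on[OF assms(2)] by simp
next
  case (Suc k)
  show ?case
    by (rule Ck_on_SucI[OF assms(1) bounded_linear.has_derivative[OF assms(2) Ck_on_derivative]])
      (use Suc in auto)
qed

lemma frechet_derivative_partial:
  fixes f :: "real^'n \<Rightarrow> real"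
  assumes "f differentiable (at x)"
  shows "frechet_derivative f (at x) v = (\<Sum>i\<in>UNIV. v $ i * partial i f x)"
proof -
  have "linear (frechet_derivative f (at x))"
    using assms by (rule linear_frechet_derivative)
  then have "frechet_derivative f (at x) (\<Sum>i\<in>UNIV. v $ i *s axis i 1) =
      (\<Sum>i\<in>UNIV. v $ i * partial i f x)"
    by (simp add: linear_sum linear_cmul partial_def scalar_mult_eq_scaleR)
  then show ?thesis by (simp add: basis_expansion)
qed

section \<open>A single fibre\<close>

text \<open>Models the restriction of \<open>F\<close> to one slit tangent space, written in chart
  components. The class is stable under adding a linear form, so its results serve both
  \<open>F\<close> and the modified function.\<close>

locale quasi_definite_fibre =
  fixes f :: "real^'n \<Rightarrow> real"
  assumes C2: "Ck_on (Suc (Suc 0)) (- {0}) f"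
    and homogeneous: "\<And>k y. 0 < k \<Longrightarrow> y \<noteq> 0 \<Longrightarrow> f (k *\<^sub>R y) = k * f y"
    and quasi_definite: "positive_quasi_definite_hessian f"
begin

abbreviation df :: "real^'n \<Rightarrow> real^'n \<Rightarrow> real" where
  "df y \<equiv> frechet_derivative f (at y)"

lemma has_derivative_df: "y \<noteq> 0 \<Longrightarrow> (f has_derivative df y) (at y)"
  using Ck_on_derivative[OF C2] by simp

lemma linear_df: "y \<noteq> 0 \<Longrightarrow> linear (df y)"
  using has_derivative_df has_derivative_linear by blast

text \<open>The function \<open>f (t *\<^sub>R y)\<close> of \<open>t\<close> is differentiated at 1
  in two ways, by the chain rule and as \<open>t * f y\<close>; the latter formula holds on the open
  half-line of positive \<open>t\<close>.\<close>

lemma euler: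
  assumes "y \<noteq> 0"
  shows "df y y = f y"
proof -
  have "((\<lambda>t. f (t *\<^sub>R y)) has_derivative (\<lambda>t. df y (t *\<^sub>R y))) (at 1)"
    by (rule has_derivative_compose[where f = "\<lambda>t. t *\<^sub>R y" and g = f])
      (auto intro!: derivative_eq_intros simp: has_derivative_df assms)
  moreover have "((\<lambda>t. f (t *\<^sub>R y)) has_derivative (\<lambda>t. t * f y)) (at 1)"
    by (rule has_derivative_transform_within_open[of "\<lambda>t. t * f y" _ _ UNIV "{0<..}"])
      (auto intro!: derivative_eq_intros simp: homogeneous assms)
  ultimately have "(\<lambda>t. df y (t *\<^sub>R y)) = (\<lambda>t. t * f y)" by (rule has_derivative_unique)
  then show ?thesis by (metis mult_1 scaleR_one)
qed

text \<open>Expanding the directional derivative in partials and differentiating each partial along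
  \<open>u\<close> gives a double sum; exchanging the sums yields the quadratic form of the
  Hessian.\<close>

lemma df_line_derivative:
  assumes "w + t *\<^sub>R u \<noteq> 0"
  shows "((\<lambda>t. df (w + t *\<^sub>R u) u) has_real_derivative
           u \<bullet> (hessian f (w + t *\<^sub>R u) *v u)) (at t)"
proof -
  let ?y = "w + t *\<^sub>R u" and ?g = "\<lambda>y. frechet_derivative f (at y) u"
  have g: "Ck_on (Suc 0) (- {0}) ?g" and p: "\<And>j. Ck_on (Suc 0) (- {0}) (partial j f)"
    using C2 unfolding Ck_on.simps(2)[of "Suc 0"] partial_def by blast+
  have "frechet_derivative ?g (at ?y) =
      frechet_derivative (\<lambda>y. \<Sum>j\<in>UNIV. u $ j * partial j f y) (at ?y)"
    by (rule frechet_derivative_cong_open[of "- {0}"])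
      (use assms C2 in \<open>auto intro: frechet_derivative_partial\<close>)
  also have "((\<lambda>y. \<Sum>j\<in>UNIV. u $ j * partial j f y) has_derivative
      (\<lambda>v. \<Sum>j\<in>UNIV. u $ j * frechet_derivative (partial j f) (at ?y) v)) (at ?y)"
    by (intro has_derivative_sum has_derivative_mult_right Ck_on_derivative[OF p])
      (use assms in auto)
  then have "frechet_derivative (\<lambda>y. \<Sum>j\<in>UNIV. u $ j * partial j f y) (at ?y) =
      (\<lambda>v. \<Sum>j\<in>UNIV. u $ j * frechet_derivative (partial j f) (at ?y) v)"
    by (rule frechet_derivative_at[symmetric])
  finally have "frechet_derivative ?g (at ?y) u =
      (\<Sum>j\<in>UNIV. u $ j * (\<Sum>i\<in>UNIV. u $ i * partial i (partial j f) ?y))"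
    using p assms by (simp add: frechet_derivative_partial)
  also have "\<dots> = (\<Sum>j\<in>UNIV. \<Sum>i\<in>UNIV. u $ i * (u $ j * partial i (partial j f) ?y))"
    by (simp add: sum_distrib_left algebra_simps)
  also have "\<dots> = u \<bullet> (hessian f ?y *v u)"
    by (subst sum.swap)
      (simp add: inner_vec_def matrix_vector_mult_def hessian_def sum_distrib_left algebra_simps)
  finally have D: "frechet_derivative ?g (at ?y) u = u \<bullet> (hessian f ?y *v u)" .
  have "((\<lambda>t. ?g (w + t *\<^sub>R u)) has_derivative
      (\<lambda>s. frechet_derivative ?g (at ?y) (s *\<^sub>R u))) (at t)"
    by (rule has_derivative_compose[where f = "\<lambda>t. w + t *\<^sub>R u" and g = ?g])
      (use assms in \<open>auto intro!: derivative_eq_intros Ck_on_derivative[OF g]\<close>)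
  moreover have "linear (frechet_derivative ?g (at ?y))"
    using Ck_on_imp_differentiable[OF g] assms by (intro linear_frechet_derivative) auto
  ultimately show ?thesis
    by (simp add: has_field_derivative_def linear_cmul D mult_commute_abs)
qed

text \<open>The line through \<open>w\<close> and \<open>y\<close> misses the origin and is nowhere
  radial, so \<open>f\<close> is strictly convex along it and lies above its tangent at
  \<open>w\<close>. By Euler's relation that tangent is the linear form \<open>df w\<close>, without
  constant term.\<close>

lemma supporting_hyperplane_strict:
  assumes "w \<noteq> 0" "\<And>k. y \<noteq> k *\<^sub>R w"
  shows "df w y < f y"
proof -
  define u where "u = y - w"
  have nz: "w + t *\<^sub>R u \<noteq> 0" for t
  proof
    assume "w + t *\<^sub>R u = 0"
    then have *: "t *\<^sub>R y = (t - 1) *\<^sub>R w" by (simp add: u_def algebra_simps)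
    then have "t \<noteq> 0" using assms(1) by auto
    then have "y = ((t - 1) / t) *\<^sub>R w"
      using * by (metis (no_types) divide_inverse_commute scaleR_one scaleR_scaleR left_inverse)
    with assms(2) show False by blast
  qed
  \<comment> \<open>The Hessian degenerates only in the radial direction, so independence of
    \<open>u\<close> from the position vector makes its quadratic form strictly positive.\<close>
  have indep: "u \<noteq> k *\<^sub>R (w + t *\<^sub>R u)" for k t
  proof
    assume "u = k *\<^sub>R (w + t *\<^sub>R u)"
    then have *: "(1 - k * t) *\<^sub>R y = (1 + k - k * t) *\<^sub>R w" by (simp add: u_def algebra_simps)
    show False
    proof (cases "1 - k * t = 0")
      case True
      with * assms(1) have "1 + k - k * t = 0" by simp
      with True show False by simp
    next
      case False
      then have "y = ((1 + k - k * t) / (1 - k * t)) *\<^sub>R w"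
        using * by (metis (no_types) divide_inverse_commute scaleR_one scaleR_scaleR left_inverse)
      with assms(2) show False by blast
    qed
  qed
  have hess: "0 < u \<bullet> (hessian f (w + t *\<^sub>R u) *v u)" for t
    using quasi_definite nz[of t] indep[of _ t] unfolding positive_quasi_definite_hessian_def
    by (metis order_le_less)
  have "((\<lambda>t. f (w + t *\<^sub>R u)) has_real_derivative df (w + t *\<^sub>R u) u) (at t)" for t
  proof -
    have "((\<lambda>t. f (w + t *\<^sub>R u)) has_derivative (\<lambda>s. df (w + t *\<^sub>R u) (s *\<^sub>R u))) (at t)"
      by (rule has_derivative_compose[where f = "\<lambda>t. w + t *\<^sub>R u" and g = f])
        (auto intro!: derivative_eq_intros has_derivative_df nz)
    then show ?thesis
      by (simp add: has_field_derivative_def linear_cmul[OF linear_df[OF nz]] mult_commute_abs)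
  qed
  \<comment> \<open>The mean value theorem is used twice: for \<open>f\<close> on the segment,
    giving a slope at \<open>\<xi>\<close>, and then for the slope between 0 and
    \<open>\<xi>\<close>, where it increases strictly.\<close>
  then obtain \<xi> where \<xi>: "0 < \<xi>" "f (w + 1 *\<^sub>R u) - f (w + 0 *\<^sub>R u) = (1 - 0) * df (w + \<xi> *\<^sub>R u) u"
    using MVT2[of 0 1 "\<lambda>t. f (w + t *\<^sub>R u)"] by force
  obtain \<eta> where "df (w + \<xi> *\<^sub>R u) u - df (w + 0 *\<^sub>R u) u =
      (\<xi> - 0) * (u \<bullet> (hessian f (w + \<eta> *\<^sub>R u) *v u))"
    using MVT2[OF \<xi>(1), of "\<lambda>t. df (w + t *\<^sub>R u) u",
        OF df_line_derivative[OF nz]] by blast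
  then have "df w u < df (w + \<xi> *\<^sub>R u) u"
    using mult_pos_pos[OF \<xi>(1) hess[of \<eta>]] by simp
  with \<xi>(2) have "f w + df w u < f y" by (simp add: u_def)
  then show ?thesis
    using euler[OF assms(1)] linear_diff[OF linear_df[OF assms(1)]] by (simp add: u_def)
qed

text \<open>A single linear form \<open>df u\<close> lies strictly below \<open>f\<close> at both
  \<open>w\<close> and \<open>- w\<close>; its two values cancel in the sum.\<close>

lemma symmetrization_pos:
  assumes "CARD('n) \<ge> 2" "w \<noteq> 0"
  shows "0 < f w + f (- w)"
proof -
  \<comment> \<open>A coordinate vector along an index \<open>j\<close> other than a nonzero
    coordinate \<open>i\<close> of \<open>w\<close> is independent of \<open>w\<close>; this takes
    dimension at least 2.\<close>
  obtain i where i: "w $ i \<noteq> 0" using assms(2) by (metis vec_eq_iff zero_index)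
  obtain j where j: "j \<noteq> i" using assms(1) by (metis UNIV_I card_2_iff' card_le_Suc0_iff_eq
      finite_class.finite_UNIV not_less_eq_eq numeral_2_eq_2)
  let ?u = "axis j 1 :: real^'n"
  have u: "?u \<noteq> 0" by (simp add: axis_eq_0_iff)
  have *: "w \<noteq> k *\<^sub>R ?u" "- w \<noteq> k *\<^sub>R ?u" for k
    using i j by (auto simp: vec_eq_iff axis_def)
  have "df ?u w < f w" "df ?u (- w) < f (- w)"
    using * by (intro supporting_hyperplane_strict[OF u]; blast)+
  then show ?thesis using linear_neg[OF linear_df[OF u], of w] by simp
qed

text \<open>Off the line of \<open>w\<close>, both \<open>df w\<close> and \<open>df (- w)\<close>
  lie strictly below \<open>f\<close>, hence so does their average. On the line one of the two
  bounds is an equality, and the gap to the average is a positive multiple of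
  \<open>f w + f (- w)\<close>.\<close>

lemma ex_covector_pos:
  assumes "CARD('n) \<ge> 2"
  shows "\<exists>a. \<forall>y. y \<noteq> 0 \<longrightarrow> 0 < f y + a \<bullet> y"
proof -
  obtain w :: "real^'n" where w: "w \<noteq> 0" by (metis zero_neq_one)
  then have w': "- w \<noteq> 0" by simp
  let ?l = "\<lambda>y. - (1 / 2) * (df w y + df (- w) y)"
  have lin: "linear ?l"
    using linear_df[OF w] linear_df[OF w']
    by (intro linearI) (simp_all add: linear_add linear_cmul algebra_simps)
  have pos: "0 < f y + ?l y" if "y \<noteq> 0" for y
  proof (cases "\<exists>k. y = k *\<^sub>R w")
    case True
    then obtain k where k: "y = k *\<^sub>R w" by blast
    with that have "k \<noteq> 0" by auto
    have dw: "df w y = k * f w" "df (- w) y = - k * f (- w)"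
      using linear_cmul[OF linear_df[OF w], of k w] linear_cmul[OF linear_df[OF w'], of "- k" "- w"]
        euler[OF w] euler[OF w'] by (simp_all add: k)
    have s: "0 < f w + f (- w)" by (rule symmetrization_pos[OF assms w])
    show ?thesis
    proof (cases "0 < k")
      case True
      then have "f y = k * f w" by (simp add: k homogeneous w)
      then show ?thesis using mult_pos_pos[OF True s] by (simp add: dw algebra_simps)
    next
      case False
      with \<open>k \<noteq> 0\<close> have "0 < - k" by simp
      then have "f y = - k * f (- w)" using homogeneous[OF _ w', of "- k"] by (simp add: k)
      then show ?thesis using mult_pos_pos[OF \<open>0 < - k\<close> s] by (simp add: dw algebra_simps)
    qed
  next
    case False
    then have "y \<noteq> k *\<^sub>R w" "y \<noteq> k *\<^sub>R (- w)" for k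
      by (metis, metis scaleR_minus_left scaleR_minus_right)
    then have "df w y < f y" "df (- w) y < f y"
      by (blast intro: supporting_hyperplane_strict[OF w] supporting_hyperplane_strict[OF w'])+
    then show ?thesis by simp
  qed
  \<comment> \<open>The adjoint of a linear functional, evaluated at 1, is the vector representing
    it under the inner product.\<close>
  have adj: "?l y = adjoint ?l 1 \<bullet> y" for y
    using adjoint_works[OF lin, of y 1] by (simp add: inner_commute)
  show ?thesis
  proof (intro exI allI impI)
    show "0 < f y + adjoint ?l 1 \<bullet> y" if "y \<noteq> 0" for y
      using pos[OF that] adj[of y] by linarith
  qed
qed

text \<open>The quadratic form of the matrix equals \<open>f y\<close> times that of the Hessian
  plus \<open>(df y v)\<^sup>2\<close>. Where the first term vanishes,
  \<open>v = k *\<^sub>R y\<close> with \<open>k\<close> nonzero, and Euler's relation gives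
  \<open>df y v = k * f y\<close>, which is nonzero.\<close>

lemma strongly_convex_if_pos:
  assumes pos: "\<And>y. y \<noteq> 0 \<Longrightarrow> 0 < f y" and "y \<noteq> 0"
  shows "positive_definite_matrix
    (\<chi> i j. f y * hessian f y $ i $ j + partial i f y * partial j f y)" (is "positive_definite_matrix ?B")
  unfolding positive_definite_matrix_def
proof (intro allI impI)
  fix v :: "real^'n" assume "v \<noteq> 0"
  have "(?B *v v) $ i = f y * (hessian f y *v v) $ i + partial i f y * df y v" for i
    using frechet_derivative_partial[of f y v] has_derivative_df[OF assms(2)]
    by (simp add: matrix_vector_mult_def differentiableI sum.distrib sum_distrib_left algebra_simps)
  then have "v \<bullet> (?B *v v) = f y * (v \<bullet> (hessian f y *v v)) + (\<Sum>i\<in>UNIV. v $ i * partial i f y) * df y v"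
    by (simp add: inner_vec_def sum.distrib sum_distrib_left sum_distrib_right algebra_simps)
  also have "(\<Sum>i\<in>UNIV. v $ i * partial i f y) = df y v"
    using frechet_derivative_partial[of f y v] has_derivative_df[OF assms(2)]
    by (simp add: differentiableI)
  finally have eq: "v \<bullet> (?B *v v) = f y * (v \<bullet> (hessian f y *v v)) + (df y v)\<^sup>2"
    by (simp add: power2_eq_square)
  have h: "0 \<le> v \<bullet> (hessian f y *v v)" "v \<bullet> (hessian f y *v v) = 0 \<longrightarrow> (\<exists>k. v = k *\<^sub>R y)"
    using quasi_definite assms(2) unfolding positive_quasi_definite_hessian_def by blast+
  show "0 < v \<bullet> (?B *v v)"
  proof (cases "v \<bullet> (hessian f y *v v) = 0")
    case True
    with h obtain k where k: "v = k *\<^sub>R y" by blast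
    then have "df y v = k * f y" "k \<noteq> 0"
      using euler[OF assms(2)] linear_cmul[OF linear_df[OF assms(2)], of k y] \<open>v \<noteq> 0\<close> by auto
    then show ?thesis unfolding eq True using pos[OF assms(2)] by simp
  next
    case False
    then show ?thesis unfolding eq using h pos[OF assms(2)]
      by (intro add_pos_nonneg mult_pos_pos) auto
  qed
qed

end

section \<open>Perturbation of a fibre function by a linear form\<close>

lemma partial_add_linear:
  fixes g :: "real^'n \<Rightarrow> real"
  assumes "open S" "y \<in> S" "\<And>y. y \<in> S \<Longrightarrow> g y = f y + l y" "f differentiable (at y)" "linear l"
  shows "partial i g y = partial i f y + l (axis i 1)"
proof -
  have "((\<lambda>y. f y + l y) has_derivative (\<lambda>v. frechet_derivative f (at y) v + l v)) (at y)"
    using assms(4,5) by (intro has_derivative_add)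
      (auto simp: frechet_derivative_works linear_linear intro: bounded_linear_imp_has_derivative)
  then have "frechet_derivative (\<lambda>y. f y + l y) (at y) = (\<lambda>v. frechet_derivative f (at y) v + l v)"
    by (metis frechet_derivative_at)
  then show ?thesis
    using frechet_derivative_cong_open[OF assms(1-3)] by (simp add: partial_def)
qed

text \<open>A linear form shifts the first partials by constants, so the Hessian is unchanged; it is
  itself homogeneous of degree 1.\<close>

lemma quasi_definite_fibre_add_linear:
  fixes g :: "real^'n \<Rightarrow> real"
  assumes "quasi_definite_fibre f" "\<And>y. y \<noteq> 0 \<Longrightarrow> g y = f y + l y" "linear l"
  shows "quasi_definite_fibre g"
proof -
  interpret quasi_definite_fibre f by fact
  have "Ck_on (Suc (Suc 0)) (- {0}) (\<lambda>y. f y + l y)"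
    by (intro Ck_on_add C2 Ck_on_linear) (use assms in \<open>auto simp: linear_linear\<close>)
  then have 1: "Ck_on (Suc (Suc 0)) (- {0}) g"
    by (rule Ck_on_cong[rotated 2]) (use assms in auto)
  have pg: "partial j g y = partial j f y + l (axis j 1)" if "y \<noteq> 0" for j y
    by (rule partial_add_linear[of "- {0}"])
      (use assms that has_derivative_df in \<open>auto intro: differentiableI\<close>)
  have "partial i (partial j g) y = partial i (partial j f) y" if "y \<noteq> 0" for i j y
  proof -
    have p: "Ck_on (Suc 0) (- {0}) (partial j f)"
      using C2 unfolding Ck_on.simps(2)[of "Suc 0"] partial_def by blast
    have "((\<lambda>y. partial j f y + l (axis j 1)) has_derivative frechet_derivative (partial j f) (at y)) (at y)"
      by (rule has_derivative_add_const) (use Ck_on_derivative[OF p] that in auto)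
    then have "frechet_derivative (\<lambda>y. partial j f y + l (axis j 1)) (at y) =
        frechet_derivative (partial j f) (at y)"
      by (metis frechet_derivative_at)
    then show ?thesis
      using frechet_derivative_cong_open[of "- {0}" y "partial j g" "\<lambda>y. partial j f y + l (axis j 1)"]
        pg that by (simp add: partial_def[of i] open_Compl)
  qed
  then have "hessian g y = hessian f y" if "y \<noteq> 0" for y using that by (simp add: hessian_def)
  then have 2: "positive_quasi_definite_hessian g"
    using quasi_definite by (simp add: positive_quasi_definite_hessian_def)
  show ?thesis
    using 1 2 assms by unfold_locales (auto simp: homogeneous linear_cmul algebra_simps)
qed


section \<open>Coordinates on the slit tangent bundle\<close>

lemma bundle_coord_image:
  assumes "smooth_manifold M A" "c \<in> A"
  shows "bundle_coord c ` slit_bundle A (U \<inter> chart_dom c) = (chart_map c ` (U \<inter> chart_dom c)) \<times> (- {0})"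
  using bij_betw_bundle_coord[OF assms, of "U \<inter> chart_dom c"] by (simp add: bij_betw_def)

lemma open_bundle_coord_image:
  assumes "smooth_manifold M A" "c \<in> A" "openin M U"
  shows "open (chart_map c ` (U \<inter> chart_dom c))"
    and "open (bundle_coord c ` slit_bundle A (U \<inter> chart_dom c))"
proof -
  have "is_chart M c" using assms by (simp add: smooth_manifold_def)
  then show o: "open (chart_map c ` (U \<inter> chart_dom c))"
    using assms(3) by (intro open_chart_image[of M]) (auto simp: is_chart_def)
  then show "open (bundle_coord c ` slit_bundle A (U \<inter> chart_dom c))"
    unfolding bundle_coord_image[OF assms(1,2)] by (intro open_Times) (auto simp: open_Compl)
qed

lemma coord_rep_bundle_coord:
  assumes "smooth_manifold M A" "c \<in> A" "z \<in> slit_bundle A (chart_dom c)"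
  shows "coord_rep A c F (bundle_coord c z) = F z"
  using bij_betw_bundle_coord[OF assms(1,2) order_refl] assms(3)
  by (simp add: coord_rep_def bij_betw_def)

text \<open>Together with \<open>ex_tangent\<close>, this translates between nonzero component
  vectors in a chart and nonzero tangent vectors.\<close>

lemma fibre_rep_tangent:
  assumes "smooth_manifold M A" "c \<in> A" "p \<in> chart_dom c" "(p, v) \<in> slit_bundle A U"
  shows "fibre_rep A c F p (v c) = F (p, v)" "v c \<noteq> 0"
proof -
  have z: "(p, v) \<in> slit_bundle A (chart_dom c)" using assms by (simp add: slit_bundle_def)
  then show "fibre_rep A c F p (v c) = F (p, v)"
    using coord_rep_bundle_coord[OF assms(1,2) z, of F] by (simp add: fibre_rep_def bundle_coord_def)
  have "bundle_coord c (p, v) \<in> bundle_coord c ` slit_bundle A (UNIV \<inter> chart_dom c)"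
    using z by simp
  then show "v c \<noteq> 0"
    unfolding bundle_coord_image[OF assms(1,2)] by (simp add: bundle_coord_def)
qed

lemma ex_tangent:
  assumes "smooth_manifold M A" "c \<in> A" "p \<in> chart_dom c" "y \<noteq> 0" "p \<in> U"
  obtains v where "(p, v) \<in> slit_bundle A U" "v c = y"
proof -
  have "(chart_map c p, y) \<in> bundle_coord c ` slit_bundle A {p}"
    using bij_betw_bundle_coord[OF assms(1,2), of "{p}"] assms by (simp add: bij_betw_def)
  then obtain v where "(p, v) \<in> slit_bundle A {p}" "v c = y"
    by (auto simp: bundle_coord_def slit_bundle_def)
  with that assms(5) show ?thesis by (auto simp: slit_bundle_def)
qed

lemma linear_transition:
  assumes "smooth_manifold M A" "c \<in> A" "d \<in> A" "p \<in> chart_dom c" "p \<in> chart_dom d"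
  shows "linear (frechet_derivative (chart_map d \<circ> chart_inv c) (at (chart_map c p)))"
  using transition_derivative[OF assms] by (rule has_derivative_linear)

lemma tangent_transition:
  assumes "(p, v) \<in> slit_bundle A U" "c \<in> A" "d \<in> A" "p \<in> chart_dom c" "p \<in> chart_dom d"
  shows "v d = frechet_derivative (chart_map d \<circ> chart_inv c) (at (chart_map c p)) (v c)"
proof -
  have "\<forall>c\<in>A. \<forall>d\<in>A. p \<in> chart_dom c \<and> p \<in> chart_dom d \<longrightarrow>
      v d = frechet_derivative (chart_map d \<circ> chart_inv c) (at (chart_map c p)) (v c)"
    using assms(1) unfolding slit_bundle_def tangent_space_def mem_Collect_eq prod.case
    by (elim conjE)
  from bspec[OF bspec[OF this assms(2)] assms(3)] show ?thesis using assms(4,5) by blast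
qed

lemma scale_tangent_slit_bundle:
  assumes "smooth_manifold M A" "(p, v) \<in> slit_bundle A U" "k \<noteq> 0"
  shows "(p, scale_tangent k v) \<in> slit_bundle A U"
proof -
  have "k *\<^sub>R v d = frechet_derivative (chart_map d \<circ> chart_inv c) (at (chart_map c p)) (k *\<^sub>R v c)"
    if "c \<in> A" "d \<in> A" "p \<in> chart_dom c" "p \<in> chart_dom d" for c d
    using linear_cmul[OF linear_transition[OF assms(1) that]] tangent_transition[OF assms(2) that] by simp
  moreover have "k *\<^sub>R v c = 0" if "c \<notin> A \<or> p \<notin> chart_dom c" for c
    using assms(2) that unfolding slit_bundle_def tangent_space_def mem_Collect_eq prod.case
    by (metis scaleR_zero_right)
  ultimately have "scale_tangent k v \<in> tangent_space A p"
    unfolding tangent_space_def scale_tangent_def mem_Collect_eq by blast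
  then show ?thesis
    using assms by (auto simp: slit_bundle_def scale_tangent_def fun_eq_iff)
qed

lemma quasi_definite_fibre_fibre_rep:
  fixes A :: "('a, 'n::finite) chart set"
  assumes M: "smooth_manifold M A" "c \<in> A" "p \<in> U" "p \<in> chart_dom c"
    and F: "smooth_on_slit A U F" "positively_homogeneous A U F" "fibrewise_quasi_definite A U F"
  shows "quasi_definite_fibre (fibre_rep A c F p)"
proof
  have "Ck_on (Suc (Suc 0)) ((chart_map c ` (U \<inter> chart_dom c)) \<times> (- {0})) (coord_rep A c F)"
    using F(1) M(2) bundle_coord_image[OF M(1,2), of U]
    unfolding smooth_on_slit_def smooth_on_def by metis
  then show "Ck_on (Suc (Suc 0)) (- {0}) (fibre_rep A c F p)"
    unfolding fibre_rep_def
    \<comment> \<open>The fibre enters the coordinate domain by \<open>y\<close> going to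
      \<open>(chart_map c p, y)\<close>, whose derivative is constantly the inclusion of the second
      factor.\<close>
    by (rule Ck_on_compose_affine[of _ _ "\<lambda>y. (0, y)", rotated 3])
      (use M in \<open>auto intro!: derivative_eq_intros simp: open_Compl\<close>)
next
  fix k :: real and y :: "real^'n" assume k: "0 < k" "y \<noteq> 0"
  obtain v where v: "(p, v) \<in> slit_bundle A U" "v c = y"
    using ex_tangent[OF M(1,2,4) k(2) M(3)] .
  have "F (p, scale_tangent k v) = k * F (p, v)"
    using F(2) v(1) k(1) unfolding positively_homogeneous_def by blast
  then show "fibre_rep A c F p (k *\<^sub>R y) = k * fibre_rep A c F p y"
    using fibre_rep_tangent(1)[OF M(1,2,4) v(1), of F] k(1) v(2)
      fibre_rep_tangent(1)[OF M(1,2,4) scale_tangent_slit_bundle[OF M(1) v(1), of k], of F]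
    by (simp add: scale_tangent_def)
next
  show "positive_quasi_definite_hessian (fibre_rep A c F p)"
    using F(3) M unfolding fibrewise_quasi_definite_def by blast
qed

text \<open>Reduces the Finsler property to positivity: strong convexity is a condition on each
  fibre in each chart, where \<open>strongly_convex_if_pos\<close> supplies it.\<close>

lemma finsler_function_if_pos:
  assumes "smooth_manifold M A" "smooth_on_slit A U F" "positively_homogeneous A U F"
    and q: "\<And>c p. c \<in> A \<Longrightarrow> p \<in> U \<Longrightarrow> p \<in> chart_dom c \<Longrightarrow> quasi_definite_fibre (fibre_rep A c F p)"
    and pos: "\<And>z. z \<in> slit_bundle A U \<Longrightarrow> 0 < F z"
  shows "finsler_function A U F"
proof -
  have "strongly_convex A U F"
    unfolding strongly_convex_def Let_def
  proof (intro ballI allI impI)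
    fix c p and y :: "real^'b" assume c: "c \<in> A" "p \<in> U \<inter> chart_dom c" "y \<noteq> 0"
    have "0 < fibre_rep A c F p w" if "w \<noteq> 0" for w
      using ex_tangent[OF assms(1) c(1) _ that, of p U] c pos fibre_rep_tangent(1)[OF assms(1) c(1)]
      by (metis IntE)
    then show "positive_definite_matrix (\<chi> i j. fibre_rep A c F p y * hessian (fibre_rep A c F p) y $ i $ j +
        partial i (fibre_rep A c F p) y * partial j (fibre_rep A c F p) y)"
      using c by (intro quasi_definite_fibre.strongly_convex_if_pos[OF q]) auto
  qed
  with assms show ?thesis by (simp add: finsler_function_def)
qed

section \<open>Adding a covector with constant coefficients in a chart\<close>

text \<open>By the chain rule, the differential of the function
  \<open>a \<bullet> chart_map c p\<close> takes the same value on a tangent vector in every chart,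
  and in chart \<open>c\<close> it has constant coefficients \<open>a\<close>. This exhibits the
  added term as a total derivative.\<close>

lemma covector_in_chart:
  fixes A :: "('a, 'n::finite) chart set" and a :: "real^'n"
  assumes M: "smooth_manifold M A" "c \<in> A" "U \<subseteq> chart_dom c"
    and v: "(p, v) \<in> slit_bundle A U" "d \<in> A" "p \<in> chart_dom d"
  shows "a \<bullet> v c = (\<Sum>i\<in>UNIV. v d $ i *
           partial i ((\<lambda>p. a \<bullet> chart_map c p) \<circ> chart_inv d) (chart_map d p))"
proof -
  have p: "p \<in> chart_dom c" using v(1) M(3) by (auto simp: slit_bundle_def)
  have D: "(((\<lambda>p. a \<bullet> chart_map c p) \<circ> chart_inv d) has_derivative
      (\<lambda>y. a \<bullet> frechet_derivative (chart_map c \<circ> chart_inv d) (at (chart_map d p)) y))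
      (at (chart_map d p))"
    using has_derivative_inner_right[OF transition_derivative[OF M(1) v(2) M(2) v(3) p], of a]
    by (simp add: o_def)
  have "a \<bullet> v c = frechet_derivative ((\<lambda>p. a \<bullet> chart_map c p) \<circ> chart_inv d) (at (chart_map d p)) (v d)"
    unfolding frechet_derivative_at[OF D, symmetric]
    using tangent_transition[OF v(1,2) M(2) v(3) p] by simp
  then show ?thesis
    using frechet_derivative_partial[OF differentiableI[OF D], of "v d"] by simp
qed

lemma smooth_fun_chart_component:
  assumes M: "smooth_manifold M A" "c \<in> A" "U \<subseteq> chart_dom c" "openin M U"
  shows "smooth_fun A U (\<lambda>p. a \<bullet> chart_map c p)"
  unfolding smooth_fun_def smooth_on_def
proof (intro ballI allI)
  fix d k assume d: "d \<in> A"
  have "Ck_on k (chart_map d ` (chart_dom d \<inter> chart_dom c)) (chart_map c \<circ> chart_inv d)"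
    using M(1,2) d unfolding smooth_manifold_def smooth_on_def by blast
  then have "Ck_on k (chart_map d ` (U \<inter> chart_dom d)) (chart_map c \<circ> chart_inv d)"
    by (rule Ck_on_subset) (use M(3) in auto)
  from Ck_on_linear_compose[OF open_bundle_coord_image(1)[OF M(1) d M(4)] bounded_linear_inner_right this]
  show "Ck_on k (chart_map d ` (U \<inter> chart_dom d)) ((\<lambda>p. a \<bullet> chart_map c p) \<circ> chart_inv d)"
    by (simp add: o_def)
qed

text \<open>In another chart \<open>d\<close> the added term is a sum of fibre coordinates times
  partials of a smooth function of the base point, so sums and products of smooth functions
  suffice.\<close>

lemma smooth_on_slit_add_covector:
  assumes M: "smooth_manifold M A" "c \<in> A" "U \<subseteq> chart_dom c" "openin M U"
    and F: "smooth_on_slit A U F"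
  shows "smooth_on_slit A U (\<lambda>z. F z + a \<bullet> snd z c)"
  unfolding smooth_on_slit_def smooth_on_def
proof (intro ballI allI)
  fix d k assume d: "d \<in> A"
  let ?S = "chart_map d ` (U \<inter> chart_dom d)" and ?W = "bundle_coord d ` slit_bundle A (U \<inter> chart_dom d)"
  let ?\<psi> = "(\<lambda>p. a \<bullet> chart_map c p) \<circ> chart_inv d"
  note op = open_bundle_coord_image[OF M(1) d M(4)]
  \<comment> \<open>One order more than the target, since the coefficients are first partials of
    \<open>?\<psi>\<close>.\<close>
  have "Ck_on (Suc k) ?S ?\<psi>"
    using smooth_fun_chart_component[OF M, of a] d unfolding smooth_fun_def smooth_on_def by blast
  then have "Ck_on k ?S (partial i ?\<psi>)" for i by (simp add: partial_def[abs_def])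
  then have "Ck_on k ?W (\<lambda>z. partial i ?\<psi> (fst z))" for i
    by (rule Ck_on_compose_affine[of _ _ fst, rotated 3])
      (use op(2) in \<open>auto intro!: derivative_eq_intros simp: bundle_coord_image[OF M(1) d]\<close>)
  moreover have "Ck_on k ?W (\<lambda>z. snd z $ i)" for i
    by (intro Ck_on_linear op) (intro bounded_linear_compose[OF bounded_linear_vec_nth] bounded_linear_snd)
  moreover have "Ck_on k ?W (coord_rep A d F)"
    using F d unfolding smooth_on_slit_def smooth_on_def by blast
  ultimately have "Ck_on k ?W (\<lambda>z. coord_rep A d F z + (\<Sum>i\<in>UNIV. snd z $ i * partial i ?\<psi> (fst z)))"
    by (intro Ck_on_add Ck_on_sum Ck_on_mult op)
  then show "Ck_on k ?W (coord_rep A d (\<lambda>z. F z + a \<bullet> snd z c))"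
  proof (rule Ck_on_cong[OF op(2), rotated])
    fix z assume "z \<in> ?W"
    then obtain p v where z: "z = bundle_coord d (p, v)" "(p, v) \<in> slit_bundle A (U \<inter> chart_dom d)"
      by auto
    then have "(p, v) \<in> slit_bundle A U" "(p, v) \<in> slit_bundle A (chart_dom d)" "p \<in> chart_dom d"
      by (auto simp: slit_bundle_def)
    then show "coord_rep A d F z + (\<Sum>i\<in>UNIV. snd z $ i * partial i ?\<psi> (fst z)) =
        coord_rep A d (\<lambda>z. F z + a \<bullet> snd z c) z"
      using covector_in_chart[OF M(1-3) _ d, of p v a]
      by (simp add: z(1) coord_rep_bundle_coord[OF M(1) d]) (simp add: bundle_coord_def)
  qed
qed

text \<open>At a fixed point the components in chart \<open>c\<close> depend linearly on those in
  chart \<open>d\<close>, so the added term is a linear form in the coordinates of either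
  chart.\<close>

lemma quasi_definite_fibre_add_covector:
  assumes M: "smooth_manifold M A" "c \<in> A" "d \<in> A" "p \<in> chart_dom c" "p \<in> chart_dom d"
    and F: "quasi_definite_fibre (fibre_rep A d F p)"
  shows "quasi_definite_fibre (fibre_rep A d (\<lambda>z. F z + a \<bullet> snd z c) p)"
proof (rule quasi_definite_fibre_add_linear[OF F])
  let ?D = "frechet_derivative (chart_map c \<circ> chart_inv d) (at (chart_map d p))"
  show "linear (\<lambda>y. a \<bullet> ?D y)"
    using linear_transition[OF M(1,3,2,5,4)]
    by (intro linearI) (simp_all add: linear_add linear_cmul inner_right_distrib)
  fix y :: "real^'b" assume "y \<noteq> 0"
  then obtain v where v: "(p, v) \<in> slit_bundle A UNIV" "v d = y"
    using ex_tangent[OF M(1,3,5)] by blast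
  show "fibre_rep A d (\<lambda>z. F z + a \<bullet> snd z c) p y = fibre_rep A d F p y + a \<bullet> ?D y"
    using fibre_rep_tangent(1)[OF M(1,3,5) v(1)] tangent_transition[OF v(1) M(3,2,5,4)] v(2) by simp
qed

lemma positively_homogeneous_add_covector:
  assumes "positively_homogeneous A U F"
  shows "positively_homogeneous A U (\<lambda>z. F z + a \<bullet> snd z c)"
  unfolding positively_homogeneous_def
proof (clarify)
  fix p v and k :: real assume "(p, v) \<in> slit_bundle A U" "0 < k"
  then have "F (p, scale_tangent k v) = k * F (p, v)"
    using assms unfolding positively_homogeneous_def by blast
  then show "F (p, scale_tangent k v) + a \<bullet> snd (p, scale_tangent k v) c = k * (F (p, v) + a \<bullet> snd (p, v) c)"
    by (simp add: scale_tangent_def algebra_simps)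
qed

section \<open>Positivity near the base point\<close>

lemma ex_neighbourhood_pos:
  fixes A :: "('a, 'n::finite) chart set" and a :: "real^'n"
  assumes M: "smooth_manifold M A" "c \<in> A" "x0 \<in> chart_dom c"
    and F: "smooth_on_slit A (topspace M) F" "positively_homogeneous A (topspace M) F"
    and pos: "\<And>y. y \<noteq> 0 \<Longrightarrow> 0 < fibre_rep A c F x0 y + a \<bullet> y"
  obtains U where "openin M U" "x0 \<in> U" "U \<subseteq> chart_dom c"
    "\<And>z. z \<in> slit_bundle A U \<Longrightarrow> 0 < F z + a \<bullet> snd z c"
proof -
  have chart: "is_chart M c" using M by (simp add: smooth_manifold_def)
  then have dom: "chart_dom c \<subseteq> topspace M" and hom: "homeomorphic_map (subtopology M (chart_dom c))
       (top_of_set (chart_map c ` chart_dom c)) (chart_map c)"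
    by (auto simp: is_chart_def openin_subset)
  let ?W = "bundle_coord c ` slit_bundle A (topspace M \<inter> chart_dom c)"
  let ?h = "\<lambda>z. coord_rep A c F z + a \<bullet> snd z"
  have W: "?W = (chart_map c ` chart_dom c) \<times> (- {0})" "open ?W"
    using bundle_coord_image[OF M(1,2), of "topspace M"] dom open_bundle_coord_image(2)[OF M(1,2), of "topspace M"]
    by (auto simp: Int_absorb1)
  have "Ck_on 0 ?W (coord_rep A c F)"
    using F(1) M(2) unfolding smooth_on_slit_def smooth_on_def by blast
  then have "continuous_on ?W ?h" by (auto intro!: continuous_intros)
  then have op: "open (?W \<inter> ?h -` {0<..})"
    using W(2) by (intro continuous_open_preimage) auto
  have "0 < ?h (chart_map c x0, y)" if "y \<in> sphere 0 1" for y
    using pos[of y] that by (cases "y = 0") (auto simp: fibre_rep_def)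
  then have "{chart_map c x0} \<times> sphere 0 1 \<subseteq> ?W \<inter> ?h -` {0<..}"
    using M(3) by (auto simp: W(1))
  \<comment> \<open>Compactness of the unit sphere gives one neighbourhood \<open>O'\<close> of the
    base point that works for all unit directions at once.\<close>
  from Elementary_Topology.tube_lemma[OF compact_sphere op this]
  obtain O' where O': "open O'" "chart_map c x0 \<in> O'" "O' \<times> sphere 0 1 \<subseteq> ?W \<inter> ?h -` {0<..}"
    by (elim exE conjE) (rule that)
  let ?U = "{p \<in> chart_dom c. chart_map c p \<in> O'}"
  have "openin (subtopology M (chart_dom c)) {p \<in> topspace (subtopology M (chart_dom c)).
      chart_map c p \<in> O' \<inter> chart_map c ` chart_dom c}"
    by (rule openin_continuous_map_preimage[OF homeomorphic_imp_continuous_map[OF hom]])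
      (use O'(1) in \<open>auto simp: openin_open\<close>)
  also have "{p \<in> topspace (subtopology M (chart_dom c)). chart_map c p \<in> O' \<inter> chart_map c ` chart_dom c} = ?U"
    using dom by auto
  finally have "openin M ?U"
    by (rule openin_trans_full) (use chart in \<open>simp add: is_chart_def\<close>)
  moreover have "0 < F z + a \<bullet> snd z c" if z: "z \<in> slit_bundle A ?U" for z
  proof -
    obtain p v where pv: "z = (p, v)" "p \<in> chart_dom c" "chart_map c p \<in> O'"
      "(p, v) \<in> slit_bundle A (topspace M)"
      using z dom by (auto simp: slit_bundle_def)
    \<comment> \<open>Rescaling to unit components in chart \<open>c\<close> brings \<open>v\<close>
      into the tube; homogeneity carries positivity back to \<open>v\<close>.\<close>
    let ?k = "inverse (norm (v c))"
    have k: "0 < ?k" using fibre_rep_tangent(2)[OF M(1,2) pv(2,4)] by simp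
    have "(chart_map c p, ?k *\<^sub>R v c) \<in> O' \<times> sphere 0 1" using pv(3) k by simp
    from subsetD[OF O'(3) this] have "?h (chart_map c p, ?k *\<^sub>R v c) > 0" by simp
    moreover have "coord_rep A c F (chart_map c p, ?k *\<^sub>R v c) = F (p, scale_tangent ?k v)"
      using fibre_rep_tangent(1)[OF M(1,2) pv(2) scale_tangent_slit_bundle[OF M(1) pv(4), of ?k], of F] k
      by (simp add: fibre_rep_def scale_tangent_def)
    moreover have "F (p, scale_tangent ?k v) = ?k * F (p, v)"
      using F(2) pv(4) k unfolding positively_homogeneous_def by blast
    ultimately have "0 < ?k * (F (p, v) + a \<bullet> v c)" by (simp add: distrib_left)
    then show ?thesis using k by (simp add: pv(1) zero_less_mult_iff)
  qed
  ultimately show ?thesis using that[of ?U] O'(2) M(3) by auto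
qed

theorem theorem1:
  fixes M :: "'a topology"
    and A :: "('a, 'n::finite) chart set"
    and F :: "'a \<times> ('a, 'n) tangent \<Rightarrow> real"
  assumes "smooth_manifold M A"
    and "paracompact_space M"
    and "CARD('n) \<ge> 3"
    and "smooth_on_slit A (topspace M) F"
    and "positively_homogeneous A (topspace M) F"
    and "fibrewise_quasi_definite A (topspace M) F"
  shows "(\<forall>x0\<in>topspace M. \<exists>U F'. openin M U \<and> x0 \<in> U \<and>
            finsler_function A U F' \<and> total_derivative A U (\<lambda>z. F' z - F z)) \<and>
         (absolutely_homogeneous A (topspace M) F \<longrightarrow> finsler_function A (topspace M) F)"
proof (intro conjI ballI impI)
  note M = assms(1)
  have card: "CARD('n) \<ge> 2" using assms(3) by simp
  have q: "quasi_definite_fibre (fibre_rep A c F p)" if "c \<in> A" "p \<in> topspace M" "p \<in> chart_dom c" for c p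
    by (rule quasi_definite_fibre_fibre_rep[OF M that assms(4-6)])
  have ex_chart: "\<exists>c\<in>A. p \<in> chart_dom c" if "p \<in> topspace M" for p
    using M that unfolding smooth_manifold_def by blast
  {
    fix x0 assume x0: "x0 \<in> topspace M"
    then obtain c where c: "c \<in> A" "x0 \<in> chart_dom c" using ex_chart by blast
    \<comment> \<open>The covector is found on the fibre at \<open>x0\<close> alone; the same
      components in chart \<open>c\<close> are then used at every point of \<open>U\<close>.\<close>
    obtain a where "\<And>y. y \<noteq> 0 \<Longrightarrow> 0 < fibre_rep A c F x0 y + a \<bullet> y"
      using quasi_definite_fibre.ex_covector_pos[OF q[OF c(1) x0 c(2)] card] by blast
    then obtain U where U: "openin M U" "x0 \<in> U" "U \<subseteq> chart_dom c"
      "\<And>z. z \<in> slit_bundle A U \<Longrightarrow> 0 < F z + a \<bullet> snd z c"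
      using ex_neighbourhood_pos[OF M c assms(4,5)] by metis
    have UM: "U \<subseteq> topspace M" using U(1) by (rule openin_subset)
    have slit: "slit_bundle A U \<subseteq> slit_bundle A (topspace M)"
      using UM by (auto simp: slit_bundle_def)
    let ?F = "\<lambda>z. F z + a \<bullet> snd z c"
    have "smooth_on_slit A U F"
      unfolding smooth_on_slit_def smooth_on_def
    proof (intro ballI allI)
      fix d k assume d: "d \<in> A"
      have "Ck_on k (bundle_coord d ` slit_bundle A (topspace M \<inter> chart_dom d)) (coord_rep A d F)"
        using assms(4) d unfolding smooth_on_slit_def smooth_on_def by blast
      then show "Ck_on k (bundle_coord d ` slit_bundle A (U \<inter> chart_dom d)) (coord_rep A d F)"
        by (rule Ck_on_subset) (use UM in \<open>auto simp: slit_bundle_def\<close>)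
    qed
    then have "smooth_on_slit A U ?F" by (rule smooth_on_slit_add_covector[OF M c(1) U(3,1)])
    moreover have "positively_homogeneous A U ?F"
      using assms(5) slit by (intro positively_homogeneous_add_covector) (auto simp: positively_homogeneous_def)
    moreover have "quasi_definite_fibre (fibre_rep A d ?F p)"
      if "d \<in> A" "p \<in> U" "p \<in> chart_dom d" for d p
      using that UM U(3) by (intro quasi_definite_fibre_add_covector[OF M c(1)] q) auto
    ultimately have "finsler_function A U ?F"
      using U(4) by (intro finsler_function_if_pos[OF M]) auto
    moreover have "total_derivative A U (\<lambda>z. ?F z - F z)"
      unfolding total_derivative_def
    proof (intro exI conjI)
      show "smooth_fun A U (\<lambda>p. a \<bullet> chart_map c p)"
        by (rule smooth_fun_chart_component[OF M c(1) U(3,1)])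
    qed (use covector_in_chart[OF M c(1) U(3)] in auto)
    ultimately show "\<exists>U F'. openin M U \<and> x0 \<in> U \<and>
        finsler_function A U F' \<and> total_derivative A U (\<lambda>z. F' z - F z)"
      using U(1,2) by blast
  }
  assume abs: "absolutely_homogeneous A (topspace M) F"
  have "0 < F z" if "z \<in> slit_bundle A (topspace M)" for z
  proof -
    obtain p v where z: "z = (p, v)" "p \<in> topspace M" using \<open>z \<in> _\<close> by (auto simp: slit_bundle_def)
    then obtain c where c: "c \<in> A" "p \<in> chart_dom c" using ex_chart by blast
    have pv: "(p, v) \<in> slit_bundle A (topspace M)" "(p, scale_tangent (- 1) v) \<in> slit_bundle A (topspace M)"
      using scale_tangent_slit_bundle[OF M, of p v _ "- 1"] that z by auto
    \<comment> \<open>Absolute homogeneity with factor -1 makes \<open>F\<close> even, so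
      \<open>symmetrization_pos\<close> says that twice \<open>F (p, v)\<close> is positive.\<close>
    have "F (p, scale_tangent (- 1) v) = F (p, v)"
      using bspec[OF abs[unfolded absolutely_homogeneous_def] pv(1)] by (auto dest: spec[of _ "- 1"])
    then have "fibre_rep A c F p (- v c) = F (p, v)"
      using fibre_rep_tangent(1)[OF M c pv(2), of F] by (simp add: scale_tangent_def)
    then show ?thesis
      using quasi_definite_fibre.symmetrization_pos[OF q[OF c(1) z(2) c(2)] card
          fibre_rep_tangent(2)[OF M c pv(1)]] fibre_rep_tangent(1)[OF M c pv(1), of F] z(1) by simp
  qed
  then show "finsler_function A (topspace M) F"
    by (intro finsler_function_if_pos[OF M assms(4,5) q])
qed

end
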